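(* Let $T=(V,E)$ be a tree on $n$ vertices and let $f=\{i,j\}$ be a pair of distinct vertices of $T$ with $f\notin E$, i.e. $d_{i,j}=d>1$. Let $B=E\cup\{f\}$ and let $N=\mathrm{Min4PC}_T[B,B]$ be the $n\times n$ principal submatrix of $\mathrm{Min4PC}_T$ whose rows and columns are indexed by $B$. Write $\det(xI-N)=\sum_{k=0}^n a_kx^k$. Then the sequence $|a_0|,|a_1|,\ldots,|a_{n-2}|$ is unimodal and log-concave. Moreover, if $|a_t|=\max_{0\le k\le n-2}|a_k|$, then $\lfloor \frac{n-2}{3}\rfloor\le t\le \lceil\frac{n+1}{3}\rceil$.
   Context: For a tree $T$, $d_{i,j}$ denotes the distance (number of edges on the path) between vertices $i,j$. Let $\mathcal{V}_2$ be the set of 2-element subsets of $V$. The matrix $\mathrm{Min4PC}_T$ is the $\binom n2\times\binom n2$ matrix with rows and columns indexed by $\mathcal{V}_2$ whose entry in row $\{i,j\}$ and column $\{k,l\}$ is $\min\{d_{i,l}+d_{j,k},\ d_{i,k}+d_{j,l},\ d_{i,j}+d_{k,l}\}$. Edges of $T$ are regarded as elements of $\mathcal{V}_2$. A sequence $a_0,\dots,a_m$ is unimodal if there is an index $k$ with $a_{j-1}\le a_j$ for $j\le k$ and $a_j\ge a_{j+1}$ for $j\ge k$; it is log-concave if $a_i^2\ge a_{i-1}a_{i+1}$ for $1\le i\le m-1$. *)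

theory Defs
  imports "HOL-Computational_Algebra.Polynomial" "HOL-Combinatorics.Permutations"
begin

definition simple_graph :: "'a set \<Rightarrow> 'a set set \<Rightarrow> bool" where
  "simple_graph V E \<longleftrightarrow> finite V \<and> (\<forall>e\<in>E. \<exists>u v. u \<in> V \<and> v \<in> V \<and> u \<noteq> v \<and> e = {u, v})"

definition walk :: "'a set set \<Rightarrow> 'a list \<Rightarrow> bool" where
  "walk E xs \<longleftrightarrow> xs \<noteq> [] \<and> (\<forall>i. Suc i < length xs \<longrightarrow> {xs ! i, xs ! Suc i} \<in> E)"

definition connected_graph :: "'a set \<Rightarrow> 'a set set \<Rightarrow> bool" where
  "connected_graph V E \<longleftrightarrow>
     (\<forall>u\<in>V. \<forall>v\<in>V. \<exists>xs. walk E xs \<and> hd xs = u \<and> last xs = v)"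

definition acyclic_graph :: "'a set set \<Rightarrow> bool" where
  "acyclic_graph E \<longleftrightarrow>
     \<not> (\<exists>xs. walk E xs \<and> length xs \<ge> 4 \<and> hd xs = last xs \<and> distinct (tl xs))"

definition is_tree :: "'a set \<Rightarrow> 'a set set \<Rightarrow> bool" where
  "is_tree V E \<longleftrightarrow> simple_graph V E \<and> V \<noteq> {} \<and> connected_graph V E \<and> acyclic_graph E"

definition dist :: "'a set set \<Rightarrow> 'a \<Rightarrow> 'a \<Rightarrow> nat" where
  "dist E u v = (LEAST k. \<exists>xs. walk E xs \<and> hd xs = u \<and> last xs = v \<and> length xs = Suc k)"

text \<open>Entry in row {i,j} and column {k,l}:
  min {d i l + d j k, d i k + d j l, d i j + d k l} (independent of the labelling).\<close>
definition min4pc :: "('a \<Rightarrow> 'a \<Rightarrow> nat) \<Rightarrow> 'a set \<Rightarrow> 'a set \<Rightarrow> nat" where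
  "min4pc d p q = Min ({d i l + d j k | i j k l. p = {i, j} \<and> q = {k, l} \<and> i \<noteq> j \<and> k \<noteq> l}
                      \<union> {d i j + d k l | i j k l. p = {i, j} \<and> q = {k, l} \<and> i \<noteq> j \<and> k \<noteq> l})"

definition Min4PC :: "'a set set \<Rightarrow> 'a set \<Rightarrow> 'a set \<Rightarrow> real" where
  "Min4PC E p q = real (min4pc (dist E) p q)"

definition charpoly_on :: "'i set \<Rightarrow> ('i \<Rightarrow> 'i \<Rightarrow> real) \<Rightarrow> real poly" where
  "charpoly_on I N =
     (\<Sum>p\<in>{p. p permutes I}. of_int (sign p) *
        (\<Prod>b\<in>I. (if p b = b then [:- N b (p b), 1:] else [:- N b (p b):])))"

definition unimodal_seq :: "(nat \<Rightarrow> real) \<Rightarrow> nat \<Rightarrow> bool" where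
  "unimodal_seq a m \<longleftrightarrow>
     (\<exists>k\<le>m. (\<forall>j. 1 \<le> j \<and> j \<le> k \<longrightarrow> a (j - 1) \<le> a j) \<and>
             (\<forall>j. k \<le> j \<and> j < m \<longrightarrow> a j \<ge> a (j + 1)))"

definition log_concave_seq :: "(nat \<Rightarrow> real) \<Rightarrow> nat \<Rightarrow> bool" where
  "log_concave_seq a m \<longleftrightarrow>
     (\<forall>i. 1 \<le> i \<and> i + 1 \<le> m \<longrightarrow> (a i)\<^sup>2 \<ge> a (i - 1) * a (i + 1))"

end

theory Submission
  imports "Jordan_Normal_Form.Determinant" Defs
begin

text \<open>Let \<open>m = n - 1 = |E|\<close>. For two edges the entry of \<open>N\<close> is 0 or 2 according to whether they
  agree, and in row \<open>f\<close> an edge has entry \<open>d - 1\<close> if it lies on the path from \<open>i\<close> to \<open>j\<close> and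
  \<open>d + 1\<close> otherwise. So \<open>N + 2I\<close> has rank at most 3, and
  \<open>det (xI - N) = (x + 2)^M (x^3 - 2M x^2 - c1 x - c0)\<close> with \<open>M = n - 3\<close>,
  \<open>c0 = 2m(d - 1)^2\<close> and \<open>c1 = 4m - 4 + m(d + 1)^2 - 4d^2\<close>.
  The coefficients of the negated cubic are log-concave, as \<open>c1^2 \<ge> 2M c0\<close>, and each of the \<open>M\<close>
  multiplications by \<open>x + 2\<close> preserves this. The mode is located by comparing with the
  coefficients of \<open>(x + 2)^M\<close>, which peak at \<open>(M + 1) div 3\<close>.\<close>

section \<open>Distances in trees\<close>

lemma walk_Cons: "walk E (x # xs) \<longleftrightarrow> xs = [] \<or> {x, hd xs} \<in> E \<and> walk E xs"
proof (cases xs)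
  case Nil
  then show ?thesis by (simp add: walk_def)
next
  case (Cons y ys)
  then show ?thesis by (force simp: walk_def nth_Cons split: nat.splits)
qed

lemma walk_append:
  "\<lbrakk>walk E xs; walk E ys; {last xs, hd ys} \<in> E\<rbrakk> \<Longrightarrow> walk E (xs @ ys)"
proof (induction xs)
  case Nil
  then show ?case by (simp add: walk_def)
next
  case (Cons x xs)
  then show ?case by (auto simp: walk_Cons split: if_splits)
qed

lemma walk_rev: "walk E xs \<Longrightarrow> walk E (rev xs)"
proof (induction xs)
  case (Cons x xs)
  have "walk E [x]" by (simp add: walk_def)
  with Cons show ?case
    by (cases "xs = []") (auto simp: walk_Cons last_rev insert_commute intro!: walk_append)
qed (simp add: walk_def)

lemma walk_take: "walk E xs \<Longrightarrow> 0 < t \<Longrightarrow> walk E (take t xs)"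
  by (auto simp: walk_def)

lemma walk_drop: "walk E xs \<Longrightarrow> t < length xs \<Longrightarrow> walk E (drop t xs)"
  by (auto simp: walk_def)

lemma walk_join:
  assumes "walk E xs" "walk E ys" "last xs = hd ys"
  shows "walk E (xs @ tl ys)"
proof (cases "tl ys = []")
  case False
  then obtain y z zs where "ys = y # z # zs" by (metis list.collapse list.sel(2))
  then show ?thesis using assms by (auto simp: walk_Cons intro!: walk_append)
qed (use assms in simp)

lemma dist_le:
  "walk E xs \<Longrightarrow> Defs.dist E (hd xs) (last xs) \<le> length xs - 1"
  unfolding Defs.dist_def by (rule Least_le) (auto simp: walk_def)

lemma dist_self [simp]: "Defs.dist E u u = 0"
  using dist_le[of E "[u]"] by (simp add: walk_def)

lemma dist_sym: "Defs.dist E u v = Defs.dist E v u"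
proof -
  have "\<exists>xs. walk E xs \<and> hd xs = v \<and> last xs = u \<and> length xs = Suc k"
    if "\<exists>xs. walk E xs \<and> hd xs = u \<and> last xs = v \<and> length xs = Suc k" for u v k
    using that by (metis walk_rev hd_rev last_rev length_rev)
  then have "(\<exists>xs. walk E xs \<and> hd xs = u \<and> last xs = v \<and> length xs = Suc k) \<longleftrightarrow>
        (\<exists>xs. walk E xs \<and> hd xs = v \<and> last xs = u \<and> length xs = Suc k)" for k
    by blast
  then show ?thesis unfolding Defs.dist_def by simp
qed

text \<open>Swapping the labels of one pair exchanges the two crossed sums, so the first set yields
  both of them. Symmetry of \<open>d\<close> collapses the second set to one sum.\<close>

lemma min4pc_doubletons:
  assumes sym: "\<And>u v. d u v = d v u" and "i \<noteq> j" "k \<noteq> l"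
  shows "min4pc d {i, j} {k, l} = min (d i l + d j k) (min (d i k + d j l) (d i j + d k l))"
proof -
  let ?A = "{d i' l' + d j' k' | i' j' k' l'.
    {i, j} = {i', j'} \<and> {k, l} = {k', l'} \<and> i' \<noteq> j' \<and> k' \<noteq> l'}"
  let ?B = "{d i' j' + d k' l' | i' j' k' l'.
    {i, j} = {i', j'} \<and> {k, l} = {k', l'} \<and> i' \<noteq> j' \<and> k' \<noteq> l'}"
  have A: "?A = {d i l + d j k, d i k + d j l}"
  proof
    show "?A \<subseteq> {d i l + d j k, d i k + d j l}"
      by (auto simp: doubleton_eq_iff)
    have "\<exists>i' j' k' l'. d i l + d j k = d i' l' + d j' k' \<and>
        {i, j} = {i', j'} \<and> {k, l} = {k', l'} \<and> i' \<noteq> j' \<and> k' \<noteq> l'"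
      using assms by blast
    moreover have "\<exists>i' j' k' l'. d i k + d j l = d i' l' + d j' k' \<and>
        {i, j} = {i', j'} \<and> {k, l} = {k', l'} \<and> i' \<noteq> j' \<and> k' \<noteq> l'"
      using assms(2,3) by (intro exI[of _ i] exI[of _ j] exI[of _ l] exI[of _ k]) auto
    ultimately show "{d i l + d j k, d i k + d j l} \<subseteq> ?A" by blast
  qed
  have B: "?B = {d i j + d k l}"
  proof
    show "?B \<subseteq> {d i j + d k l}" using sym[of j i] sym[of l k] by (auto simp: doubleton_eq_iff)
    show "{d i j + d k l} \<subseteq> ?B" using assms(2,3) by blast
  qed
  show ?thesis unfolding min4pc_def A B by simp
qed

section \<open>Distance levels in a rooted tree\<close>

locale tree =
  fixes V :: "'a set" and E :: "'a set set"
  assumes tree: "is_tree V E"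
begin

abbreviation d :: "'a \<Rightarrow> 'a \<Rightarrow> nat" where "d \<equiv> Defs.dist E"

lemma finite_V: "finite V"
  using tree by (simp add: is_tree_def simple_graph_def)

lemma edge_cases:
  assumes "e \<in> E"
  obtains u v where "e = {u, v}" "u \<in> V" "v \<in> V" "u \<noteq> v"
  using tree assms unfolding is_tree_def simple_graph_def by blast

lemma edgeD:
  assumes "{u, v} \<in> E"
  shows "u \<in> V" "v \<in> V" "u \<noteq> v"
  using edge_cases[OF assms] by (metis doubleton_eq_iff)+

lemma finite_E: "finite E"
proof -
  have "E \<subseteq> Pow V" by (auto elim!: edge_cases)
  then show ?thesis using finite_V finite_subset by blast
qed

lemma shortest_walk:
  assumes "u \<in> V" "v \<in> V"
  obtains xs where "walk E xs" "hd xs = u" "last xs = v" "length xs = Suc (d u v)"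
proof -
  obtain xs where xs: "walk E xs" "hd xs = u" "last xs = v"
    using tree assms unfolding is_tree_def connected_graph_def by blast
  have "\<exists>k xs. walk E xs \<and> hd xs = u \<and> last xs = v \<and> length xs = Suc k"
    using xs by (intro exI[of _ "length xs - 1"] exI[of _ xs]) (auto simp: walk_def)
  from LeastI_ex[OF this] show ?thesis using that unfolding Defs.dist_def by blast
qed

lemma d_0: "u \<in> V \<Longrightarrow> v \<in> V \<Longrightarrow> d u v = 0 \<Longrightarrow> u = v"
  by (erule (1) shortest_walk) (auto simp: length_Suc_conv)

lemma d_triangle:
  assumes "u \<in> V" "v \<in> V" "w \<in> V"
  shows "d u w \<le> d u v + d v w"
proof -
  obtain xs where xs: "walk E xs" "hd xs = u" "last xs = v" "length xs = Suc (d u v)"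
    by (rule shortest_walk[OF assms(1,2)])
  obtain ys where ys: "walk E ys" "hd ys = v" "last ys = w" "length ys = Suc (d v w)"
    by (rule shortest_walk[OF assms(2,3)])
  have "walk E (xs @ tl ys)" using walk_join xs ys by metis
  moreover have "hd (xs @ tl ys) = u" using xs by (cases xs) auto
  moreover have "last (xs @ tl ys) = w" using xs ys by (cases ys) auto
  ultimately show ?thesis using dist_le[of E "xs @ tl ys"] xs(4) ys(4) by simp
qed

lemma d_edge:
  assumes "{u, v} \<in> E"
  shows "d u v = 1"
proof -
  have "d u v \<le> 1" using dist_le[of E "[u, v]"] assms by (simp add: walk_Cons walk_def)
  moreover have "d u v \<noteq> 0" using d_0 edgeD[OF assms] by blast
  ultimately show ?thesis by simp
qed

lemma d_edge_le:
  assumes "r \<in> V" "{u, v} \<in> E"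
  shows "d r v \<le> Suc (d r u)"
  using d_triangle[OF assms(1) edgeD(1,2)[OF assms(2)]] d_edge[OF assms(2)] by simp

text \<open>The second vertex of a shortest walk from \<open>v\<close> back to \<open>r\<close> is
  one step closer to \<open>r\<close>.\<close>

lemma ex_parent:
  assumes "r \<in> V" "v \<in> V" "d r v = Suc s"
  obtains u where "{u, v} \<in> E" "d r u = s"
proof -
  obtain xs where xs: "walk E xs" "hd xs = v" "last xs = r" "length xs = Suc (d v r)"
    by (rule shortest_walk[OF assms(2,1)])
  then obtain u us where us: "xs = v # u # us"
    using assms(3) dist_sym[of E v r] by (auto simp: length_Suc_conv)
  have e: "{u, v} \<in> E" using xs us by (simp add: walk_Cons insert_commute)
  have "walk E (u # us)" using xs us by (simp add: walk_Cons)
  from dist_le[OF this] have "d u r \<le> s"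
    using xs us assms(3) dist_sym[of E v r] by simp
  moreover have "Suc s \<le> Suc (d r u)" using d_edge_le[OF assms(1) e] assms(3) by simp
  ultimately show ?thesis using that e dist_sym[of E u r] by simp
qed

lemma no_cycle:
  "\<lbrakk>walk E xs; length xs \<ge> 4; hd xs = last xs; distinct (tl xs)\<rbrakk> \<Longrightarrow> False"
  using tree unfolding is_tree_def acyclic_graph_def by blast

text \<open>Climb from both vertices to their parents until these coincide. The path never goes
  below level \<open>s\<close> and has at least 3 vertices, so an edge between its ends, or a common
  neighbour one level deeper, closes it to a cycle as \<open>acyclic_graph\<close> understands
  it.\<close>

lemma path_below_level:
  assumes "r \<in> V" "a \<in> V" "b \<in> V" "a \<noteq> b" "d r a = s" "d r b = s"
  shows "\<exists>zs. walk E zs \<and> hd zs = a \<and> last zs = b \<and> distinct zs \<and> length zs \<ge> 3 \<and>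
           (\<forall>z\<in>set zs. d r z \<le> s)"
  using assms
proof (induction s arbitrary: a b)
  case 0
  then show ?case using d_0 by metis
next
  case (Suc s)
  obtain a' where a': "{a', a} \<in> E" "d r a' = s" using ex_parent Suc.prems by metis
  obtain b' where b': "{b', b} \<in> E" "d r b' = s" using ex_parent Suc.prems by metis
  show ?case
  proof (cases "a' = b'")
    case True
    then have "walk E [a, a', b]"
      using a' b' by (simp add: walk_Cons insert_commute)
    then show ?thesis using a' b' Suc.prems True by (intro exI[of _ "[a, a', b]"]) auto
  next
    case False
    then obtain zs where zs: "walk E zs" "hd zs = a'" "last zs = b'" "distinct zs"
        "length zs \<ge> 3" "\<forall>z\<in>set zs. d r z \<le> s"
      using Suc.IH[of a' b'] Suc.prems a' b' edgeD by blast
    have "walk E (zs @ [b])"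
      using zs b' by (intro walk_append) (auto simp: walk_def)
    then have "walk E (a # zs @ [b])"
      using zs a' by (auto simp: walk_Cons insert_commute hd_append)
    moreover have "distinct (a # zs @ [b])" using zs Suc.prems by fastforce
    ultimately show ?thesis using zs Suc.prems
      by (intro exI[of _ "a # zs @ [b]"]) auto
  qed
qed

text \<open>An edge inside a level would close the path from \<open>path_below_level\<close> to a
  cycle.\<close>

lemma edge_levels_neq:
  assumes "r \<in> V" "{a, b} \<in> E"
  shows "d r a \<noteq> d r b"
proof
  assume eq: "d r a = d r b"
  obtain zs where zs: "walk E zs" "hd zs = a" "last zs = b" "distinct zs" "length zs \<ge> 3"
    using path_below_level[OF assms(1) edgeD[OF assms(2)] eq refl] by blast
  have "walk E (zs @ [a])"
    using zs assms by (intro walk_append) (auto simp: walk_def insert_commute)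
  moreover have "distinct (tl (zs @ [a]))" "hd (zs @ [a]) = a"
    using zs by (cases zs; auto)+
  ultimately show False using no_cycle zs by fastforce
qed

lemma edge_levels:
  assumes "r \<in> V" "{a, b} \<in> E"
  shows "d r b = Suc (d r a) \<or> d r a = Suc (d r b)"
  using edge_levels_neq[OF assms] d_edge_le[OF assms] d_edge_le[of r b a] assms
  by (auto simp: insert_commute)

text \<open>Two different parents would be joined by a path on levels above \<open>v\<close>. This
  path avoids \<open>v\<close>, so adding \<open>v\<close> gives a cycle.\<close>

lemma parent_unique:
  assumes "r \<in> V" "{a, v} \<in> E" "{b, v} \<in> E" "d r v = Suc (d r a)" "d r v = Suc (d r b)"
  shows "a = b"
proof (rule ccontr)
  assume "a \<noteq> b"
  then obtain zs where zs: "walk E zs" "hd zs = a" "last zs = b" "distinct zs"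
      "length zs \<ge> 3" "\<forall>z\<in>set zs. d r z \<le> d r a"
    using path_below_level[of r a b "d r a"] assms edgeD by auto
  have "walk E (zs @ [v])"
    using zs assms by (intro walk_append) (auto simp: walk_def)
  then have "walk E (v # zs @ [v])"
    using zs assms by (auto simp: walk_Cons insert_commute hd_append)
  moreover have "v \<notin> set zs" using zs assms by fastforce
  ultimately show False using no_cycle[of "v # zs @ [v]"] zs by auto
qed

text \<open>After fixing a root \<open>r\<close>, sending each other vertex to the edge to its
  parent is a bijection onto \<open>E\<close>.\<close>

lemma card_V: "card V = Suc (card E)"
proof -
  obtain r where r: "r \<in> V" using tree unfolding is_tree_def by blast
  have "\<exists>u. {u, v} \<in> E \<and> d r v = Suc (d r u)" if "v \<in> V - {r}" for v
  proof -
    have "d r v \<noteq> 0" using that r d_0 by blast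
    then show ?thesis using that r ex_parent by (metis DiffD1 not0_implies_Suc)
  qed
  then obtain par where par: "\<And>v. v \<in> V - {r} \<Longrightarrow> {par v, v} \<in> E \<and> d r v = Suc (d r (par v))"
    by metis
  have "bij_betw (\<lambda>v. {par v, v}) (V - {r}) E"
  proof (intro bij_betw_imageI inj_onI equalityI subsetI)
    fix v w assume vw: "v \<in> V - {r}" "w \<in> V - {r}" "{par v, v} = {par w, w}"
    show "v = w"
    proof (rule ccontr)
      assume "v \<noteq> w"
      then have "v = par w" "w = par v" using vw(3) by (auto simp: doubleton_eq_iff)
      then show False using par[OF vw(1)] par[OF vw(2)] by simp
    qed
  next
    fix e assume "e \<in> E"
    then obtain k l where e: "{k, l} \<in> E" "e = {k, l}" by (metis edge_cases)
    have "\<exists>k l. {k, l} \<in> E \<and> e = {k, l} \<and> d r l = Suc (d r k)"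
      using edge_levels[OF r e(1)] e by (metis insert_commute)
    then obtain k l where kl: "{k, l} \<in> E" "e = {k, l}" "d r l = Suc (d r k)" by blast
    then have l: "l \<in> V - {r}" using edgeD[OF kl(1)] by auto
    then have "par l = k" using parent_unique[OF r _ kl(1)] par kl(3) by blast
    then show "e \<in> (\<lambda>v. {par v, v}) ` (V - {r})" using l kl by blast
  qed (use par in auto)
  then have "card (V - {r}) = card E" by (rule bij_betw_same_card)
  then show ?thesis using r finite_V card.remove by metis
qed

section \<open>Edges on the path between two vertices\<close>

text \<open>The path is described by distances alone: an edge lies on it if crossing the edge leads
  away from \<open>i\<close> and towards \<open>j\<close>.\<close>

definition path_edges :: "'a \<Rightarrow> 'a \<Rightarrow> 'a set set" where
  "path_edges i j = {e\<in>E. \<exists>k l. e = {k, l} \<and> d i l = Suc (d i k) \<and> d j k = Suc (d j l)}"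

text \<open>Removing \<open>{k, l}\<close> splits the tree into the vertices nearer to
  \<open>k\<close> and those nearer to \<open>l\<close>, and no other edge joins the two sides. If
  \<open>b\<close> were not \<open>l\<close>, its neighbour towards \<open>l\<close> would also be
  its parent as seen from \<open>k\<close>, hence equal to \<open>a\<close>, which lies too far from
  \<open>l\<close> for that.\<close>

lemma separating_edge_unique:
  assumes ab: "{a, b} \<in> E" and kl: "{k, l} \<in> E"
    and a: "d a k < d a l" and b: "d b l < d b k"
  shows "a = k \<and> b = l"
proof -
  note V = edgeD[OF ab] edgeD[OF kl]
  have a': "d a l = Suc (d a k)" using edge_levels[OF V(1) kl] a by linarith
  have b': "d b k = Suc (d b l)" using edge_levels[OF V(2) kl] b by linarith
  have la: "d l a \<le> Suc (d l b)" using d_edge_le[OF V(5), of b a] ab by (simp add: insert_commute)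
  have kb: "d k b = Suc (d k a)"
    using edge_levels[OF V(4) ab] la a' b' 
    by (auto simp: dist_sym[of E a k] dist_sym[of E b k] dist_sym[of E a l] dist_sym[of E b l])
  have lb: "d l b = d k a" using kb b'
    by (simp add: dist_sym[of E a k] dist_sym[of E b k] dist_sym[of E a l] dist_sym[of E b l])
  show ?thesis
  proof (cases "d l b")
    case 0
    then show ?thesis using lb d_0 V by metis
  next
    case (Suc s)
    then obtain b' where b2: "{b', b} \<in> E" "d l b' = s" using ex_parent V by metis
    have "d k b' \<le> Suc s"
      using d_triangle[OF V(4,5), of b'] d_edge[OF kl] b2 edgeD[OF b2(1)] by simp
    then have "d k b = Suc (d k b')" using edge_levels[OF V(4) b2(1)] kb lb Suc by auto
    then have "b' = a" by (rule parent_unique[OF V(4) b2(1) ab _ kb])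
    then have "d l a = s" using b2(2) by blast
    then show ?thesis using a' lb Suc dist_sym[of E a l] dist_sym[of E a k] by linarith
  qed
qed

text \<open>The edges in \<open>path_edges i j\<close> are exactly the consecutive pairs of a
  shortest walk from \<open>i\<close> to \<open>j\<close>; both claims are read off from the
  positions on that walk.\<close>

lemma path_edges_geodesic:
  assumes ij: "i \<in> V" "j \<in> V"
  shows "card (path_edges i j) = d i j"
    and "\<lbrakk>{k, l} \<in> E; d i l = Suc (d i k); d j k = Suc (d j l)\<rbrakk> \<Longrightarrow> d i k + d j l + 1 = d i j"
proof -
  obtain xs where xs: "walk E xs" "hd xs = i" "last xs = j" "length xs = Suc (d i j)"
    by (rule shortest_walk[OF ij])
  have edge: "{xs ! t, xs ! Suc t} \<in> E" if "t < d i j" for t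
    using that xs by (auto simp: walk_def)
  have ne: "xs \<noteq> []" using xs by auto
  have ends: "xs ! 0 = i" "xs ! d i j = j"
    using xs ne by (auto simp: hd_conv_nth last_conv_nth)
  have inV: "xs ! t \<in> V" if "t \<le> d i j" for t
  proof (cases "t < d i j")
    case True
    then show ?thesis using edge edgeD by blast
  next
    case False
    then show ?thesis using that ends ij by simp
  qed
  \<comment> \<open>The two pieces of the walk bound the distances from above, and the triangle
    inequality forces equality.\<close>
  have lev: "d i (xs ! t) = t \<and> d j (xs ! t) = d i j - t" if t: "t \<le> d i j" for t
  proof -
    have "walk E (take (Suc t) xs)" "walk E (drop t xs)"
      using xs t by (simp_all add: walk_take walk_drop)
    moreover have "hd (take (Suc t) xs) = i" using xs(2) ne by (cases xs) auto
    moreover have "last (take (Suc t) xs) = xs ! t"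
      using xs t by (simp add: take_Suc_conv_app_nth)
    ultimately have "d i (xs ! t) \<le> t" "d (xs ! t) j \<le> d i j - t"
      using dist_le[of E "take (Suc t) xs"] dist_le[of E "drop t xs"] xs t
      by (auto simp: hd_drop_conv_nth)
    moreover have "d i j \<le> d i (xs ! t) + d (xs ! t) j"
      using d_triangle inV t ij by blast
    ultimately show ?thesis using t dist_sym[of E j "xs ! t"] by linarith
  qed
  have on_walk: "\<exists>t<d i j. k = xs ! t \<and> l = xs ! Suc t"
    if kl: "{k, l} \<in> E" "d i l = Suc (d i k)" "d j k = Suc (d j l)" for k l
  proof -
    \<comment> \<open>A discrete intermediate value argument: the start of the walk is nearer to
      \<open>k\<close> and its end nearer to \<open>l\<close>, so some step changes sides, and only
      the edge \<open>{k, l}\<close> can do so.\<close>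
    let ?Q = "\<lambda>t. d (xs ! t) l < d (xs ! t) k"
    have Q0: "\<not> ?Q 0" and Qd: "?Q (d i j)" using kl ends by auto
    then obtain t where t: "t < d i j" "\<not> ?Q t" "?Q (Suc t)"
      using ex_least_nat_less[of ?Q "d i j"] by auto
    then have "d (xs ! t) k < d (xs ! t) l"
      using edge_levels[OF inV kl(1), of t] by linarith
    then show ?thesis using separating_edge_unique[OF edge kl(1)] t by blast
  qed
  show "d i k + d j l + 1 = d i j"
    if kl: "{k, l} \<in> E" "d i l = Suc (d i k)" "d j k = Suc (d j l)"
    using on_walk[OF kl] lev by fastforce
  have "path_edges i j = (\<lambda>t. {xs ! t, xs ! Suc t}) ` {..<d i j}"
  proof (intro equalityI subsetI)
    fix e assume "e \<in> path_edges i j"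
    then show "e \<in> (\<lambda>t. {xs ! t, xs ! Suc t}) ` {..<d i j}"
      unfolding path_edges_def using on_walk by blast
  next
    fix e assume "e \<in> (\<lambda>t. {xs ! t, xs ! Suc t}) ` {..<d i j}"
    then obtain t where t: "t < d i j" "e = {xs ! t, xs ! Suc t}" by auto
    then have "d i (xs ! Suc t) = Suc (d i (xs ! t))" "d j (xs ! t) = Suc (d j (xs ! Suc t))"
      using lev[of t] lev[of "Suc t"] by auto
    then show "e \<in> path_edges i j"
      unfolding path_edges_def using edge[OF t(1)] t(2) by blast
  qed
  moreover have "inj_on (\<lambda>t. {xs ! t, xs ! Suc t}) {..<d i j}"
  proof (rule inj_onI)
    fix s t assume st: "s \<in> {..<d i j}" "t \<in> {..<d i j}"
      and eq: "{xs ! s, xs ! Suc s} = {xs ! t, xs ! Suc t}"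
    have "d i (xs ! s) = s" "d i (xs ! t) = t" "d i (xs ! Suc s) = Suc s" "d i (xs ! Suc t) = Suc t"
      using st lev by (simp_all only: Suc_le_eq lessThan_iff less_imp_le_nat)
    moreover have "xs ! s = xs ! t \<or> xs ! s = xs ! Suc t \<and> xs ! Suc s = xs ! t"
      using eq unfolding doubleton_eq_iff by blast
    ultimately have "s = t \<or> s = Suc t \<and> Suc s = t" by metis
    then show "s = t" by linarith
  qed
  ultimately show "card (path_edges i j) = d i j" by (simp add: card_image)
qed

section \<open>Matrix entries in terms of the path\<close>

text \<open>Let \<open>k\<close> be the end of \<open>e\<close> nearer to \<open>i\<close>. On the
  path the minimum is \<open>d i k + d j l\<close>, which misses just the edge itself. Off the path
  \<open>j\<close> is nearer to \<open>k\<close> as well, both crossed sums equal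
  \<open>d i k + d j k + 1\<close>, and \<open>d i j + 1\<close> is the minimum.\<close>

lemma Min4PC_pair_edge:
  assumes ij: "i \<in> V" "j \<in> V" "i \<noteq> j" and e: "e \<in> E"
  shows "Min4PC E {i, j} e = (if e \<in> path_edges i j then real (d i j) - 1 else real (d i j) + 1)"
    and "Min4PC E e {i, j} = Min4PC E {i, j} e"
proof -
  obtain k l where "{k, l} \<in> E" "e = {k, l}" using e by (metis edge_cases)
  then have "\<exists>k l. {k, l} \<in> E \<and> e = {k, l} \<and> d i l = Suc (d i k)"
    using edge_levels[OF ij(1), of k l] by (metis insert_commute)
  then obtain k l where kl: "{k, l} \<in> E" "e = {k, l}" "d i l = Suc (d i k)" by blast
  note V = edgeD[OF kl(1)]
  have min: "min4pc d {i, j} e = min (d i l + d j k) (min (d i k + d j l) (d i j + 1))"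
    unfolding kl(2) using min4pc_doubletons[of d, OF dist_sym ij(3) V(3)] d_edge[OF kl(1)] by simp
  have "min4pc d e {i, j} = min (d k j + d l i) (min (d k i + d l j) (d k l + d i j))"
    unfolding kl(2) using min4pc_doubletons[of d, OF dist_sym V(3) ij(3)] by simp
  then have "min4pc d e {i, j} = min4pc d {i, j} e"
    unfolding min using d_edge[OF kl(1)]
    by (simp add: dist_sym[of E k i] dist_sym[of E k j] dist_sym[of E l i] dist_sym[of E l j] add.commute)
  then show "Min4PC E e {i, j} = Min4PC E {i, j} e" unfolding Min4PC_def by simp
  have tri: "d i j \<le> d i k + d j k"
    using d_triangle[OF ij(1) V(1) ij(2)] by (simp add: dist_sym[of E k j])
  consider "d j k = Suc (d j l)" | "d j l = Suc (d j k)"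
    using edge_levels[OF ij(2) kl(1)] by blast
  then show "Min4PC E {i, j} e =
      (if e \<in> path_edges i j then real (d i j) - 1 else real (d i j) + 1)"
  proof cases
    case 1
    then have "e \<in> path_edges i j" unfolding path_edges_def using kl by blast
    moreover have "min4pc d {i, j} e + 1 = d i j"
      unfolding min using path_edges_geodesic(2)[OF ij(1,2) kl(1,3) 1] 1 kl(3) by simp
    ultimately show ?thesis unfolding Min4PC_def by simp
  next
    case 2
    then have "e \<notin> path_edges i j" unfolding path_edges_def using kl
      by (auto simp: doubleton_eq_iff)
    moreover have "min4pc d {i, j} e = d i j + 1"
      unfolding min using 2 kl(3) tri by simp
    ultimately show ?thesis unfolding Min4PC_def by simp
  qed
qed

lemma Min4PC_self:
  assumes "i \<noteq> j"
  shows "Min4PC E {i, j} {i, j} = 0"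
  unfolding Min4PC_def using min4pc_doubletons[of d, OF dist_sym assms assms] by simp

text \<open>An edge is a pair at distance 1 whose path consists of that edge alone, so the formula
  for a pair and an edge applies.\<close>

lemma Min4PC_edge_edge:
  assumes "e \<in> E" "g \<in> E"
  shows "Min4PC E e g = (if e = g then 0 else 2)"
proof -
  obtain u v where uv: "e = {u, v}" "u \<in> V" "v \<in> V" "u \<noteq> v" using assms edge_cases by blast
  then have d: "d u v = 1" using d_edge assms by blast
  have "d u v = Suc (d u u)" "d v u = Suc (d v v)" using d dist_sym[of E v u] by auto
  then have "e \<in> path_edges u v" unfolding path_edges_def using assms uv by blast
  moreover have "card (path_edges u v) = 1" using path_edges_geodesic(1) uv d by simp
  ultimately have "path_edges u v = {e}" by (metis card_1_singletonE singletonD)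
  then show ?thesis using Min4PC_pair_edge(1)[OF uv(2-4) assms(2)] uv(1) d by auto
qed

end

section \<open>The characteristic polynomial\<close>

text \<open>Transporting permutations along the enumeration \<open>h\<close> keeps their signs and
  the products. This links the Leibniz sum over an arbitrary index set with
  \<open>det\<close>.\<close>

lemma sum_permutes_eq_det:
  fixes A :: "'i \<Rightarrow> 'i \<Rightarrow> 'b :: comm_ring_1"
  assumes h: "bij_betw h {0..<n} I"
  shows "(\<Sum>p\<in>{p. p permutes I}. of_int (sign p) * (\<Prod>b\<in>I. A b (p b))) =
    det (mat n n (\<lambda>(a, b). A (h a) (h b)))"
proof -
  let ?J = "{0..<n}"
  define h' where "h' = inv_into ?J h"
  have inj: "inj_on h ?J" using h by (simp add: bij_betw_def)
  have h': "bij_betw h' I ?J" unfolding h'_def using h by (rule bij_betw_inv_into)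
  have inv: "h' (h a) = a" if "a \<in> ?J" for a
    unfolding h'_def using inj that by (rule inv_into_f_f)
  have inv': "h (h' b) = b" if "b \<in> I" for b
    unfolding h'_def using h that by (rule bij_betw_inv_into_right)
  have bij: "bij_betw (map_permutation ?J h) {p. p permutes ?J} {p. p permutes I}"
  proof (rule bij_betw_byWitness[where f' = "map_permutation I h'"])
    show "\<forall>p\<in>{p. p permutes ?J}. map_permutation I h' (map_permutation ?J h p) = p"
      using map_permutation_compose_inv[OF h] inv by auto
    show "\<forall>p\<in>{p. p permutes I}. map_permutation ?J h (map_permutation I h' p) = p"
      using map_permutation_compose_inv[OF h'] inv' by auto
    show "map_permutation ?J h ` {p. p permutes ?J} \<subseteq> {p. p permutes I}"
      using map_permutation_permutes[OF h] by auto
    show "map_permutation I h' ` {p. p permutes I} \<subseteq> {p. p permutes ?J}"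
      using map_permutation_permutes[OF h'] by auto
  qed
  have "(\<Sum>p\<in>{p. p permutes I}. of_int (sign p) * (\<Prod>b\<in>I. A b (p b))) =
    (\<Sum>p\<in>{p. p permutes ?J}. of_int (sign (map_permutation ?J h p)) *
       (\<Prod>b\<in>I. A b (map_permutation ?J h p b)))"
    by (rule sum.reindex_bij_betw[OF bij, symmetric])
  also have "\<dots> = (\<Sum>p\<in>{p. p permutes ?J}. of_int (sign p) * (\<Prod>a\<in>?J. A (h a) (h (p a))))"
  proof (rule sum.cong[OF refl])
    fix p assume p: "p \<in> {p. p permutes ?J}"
    have "(\<Prod>b\<in>I. A b (map_permutation ?J h p b)) =
        (\<Prod>a\<in>?J. A (h a) (map_permutation ?J h p (h a)))"
      by (rule prod.reindex_bij_betw[OF h, symmetric])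
    also have "\<dots> = (\<Prod>a\<in>?J. A (h a) (h (p a)))"
      by (rule prod.cong[OF refl]) (simp add: map_permutation_apply[OF inj])
    finally show "of_int (sign (map_permutation ?J h p)) * (\<Prod>b\<in>I. A b (map_permutation ?J h p b))
      = of_int (sign p) * (\<Prod>a\<in>?J. A (h a) (h (p a)))"
      using p sign_map_permutation[OF inj] by simp
  qed
  also have "\<dots> = det (mat n n (\<lambda>(a, b). A (h a) (h b)))"
    by (subst det_def'[of _ n])
       (auto intro!: sum.cong prod.cong simp: permutes_in_image)
  finally show ?thesis .
qed

text \<open>Evaluation at a point gives a matrix over a field, in which \<open>x + 2\<close> can be
  inverted.\<close>

lemma poly_charpoly_on:
  assumes h: "bij_betw h {0..<n} I"
  shows "poly (charpoly_on I N) x =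
    det (mat n n (\<lambda>(a, b). (if a = b then x else 0) - N (h a) (h b)))"
proof -
  have "poly (charpoly_on I N) x = (\<Sum>p\<in>{p. p permutes I}. of_int (sign p) *
      (\<Prod>b\<in>I. (if b = p b then x else 0) - N b (p b)))"
    unfolding charpoly_on_def poly_sum poly_mult poly_prod poly_of_int
    by (intro sum.cong prod.cong arg_cong2[of _ _ _ _ "(*)"]) auto
  also have "\<dots> = det (mat n n (\<lambda>(a, b). (if h a = h b then x else 0) - N (h a) (h b)))"
    by (rule sum_permutes_eq_det[OF h])
  also have "mat n n (\<lambda>(a, b). (if h a = h b then x else 0) - N (h a) (h b)) =
      mat n n (\<lambda>(a, b). (if a = b then x else 0) - N (h a) (h b))"
    using h by (intro eq_matI) (auto simp: bij_betw_def inj_on_def)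
  finally show ?thesis .
qed

text \<open>Sylvester's determinant identity: the determinant of one block matrix is computed
  through both of its Schur complements.\<close>

lemma det_smult_one_minus_mult:
  fixes U W :: "'b :: field mat"
  assumes U: "U \<in> carrier_mat n k" and W: "W \<in> carrier_mat k n" and y: "y \<noteq> 0"
  shows "det (y \<cdot>\<^sub>m 1\<^sub>m n - U * W) = y ^ n * det (1\<^sub>m k - inverse y \<cdot>\<^sub>m (W * U))"
proof -
  let ?K = "four_block_mat (1\<^sub>m k) W U (y \<cdot>\<^sub>m 1\<^sub>m n)"
  \<comment> \<open>Elimination with the identity block leaves the Schur complement of size
    \<open>n\<close>.\<close>
  have "?K = four_block_mat (1\<^sub>m k) (0\<^sub>m k n) U (1\<^sub>m n) *
      four_block_mat (1\<^sub>m k) W (0\<^sub>m n k) (y \<cdot>\<^sub>m 1\<^sub>m n - U * W)"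
  proof -
    have "U * W + (y \<cdot>\<^sub>m 1\<^sub>m n - U * W) = y \<cdot>\<^sub>m 1\<^sub>m n"
      using U W by (intro eq_matI) auto
    moreover have "1\<^sub>m n * (y \<cdot>\<^sub>m 1\<^sub>m n - U * W) = y \<cdot>\<^sub>m 1\<^sub>m n - U * W"
      using U W by (intro left_mult_one_mat[of _ n n]) auto
    ultimately show ?thesis
      using U W by (subst mult_four_block_mat[of _ k k _ n _ n]) auto
  qed
  then have "det ?K = det (four_block_mat (1\<^sub>m k) (0\<^sub>m k n) U (1\<^sub>m n)) *
      det (four_block_mat (1\<^sub>m k) W (0\<^sub>m n k) (y \<cdot>\<^sub>m 1\<^sub>m n - U * W))"
    using U W by (simp only:, intro det_mult[of _ "k + n"] four_block_carrier_mat) auto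
  also have "\<dots> = det (y \<cdot>\<^sub>m 1\<^sub>m n - U * W)"
    using U W by (subst det_four_block_mat_upper_right_zero[of _ k _ n], simp_all,
        subst det_four_block_mat_lower_left_zero[of _ k _ n], auto)
  finally have *: "det ?K = det (y \<cdot>\<^sub>m 1\<^sub>m n - U * W)" .
  \<comment> \<open>Elimination with the block \<open>y\<close> times the identity, invertible as
    \<open>y\<close> is nonzero, leaves the Schur complement of size \<open>k\<close>.\<close>
  have "?K = four_block_mat (1\<^sub>m k - inverse y \<cdot>\<^sub>m (W * U)) W (0\<^sub>m n k) (y \<cdot>\<^sub>m 1\<^sub>m n) *
      four_block_mat (1\<^sub>m k) (0\<^sub>m k n) (inverse y \<cdot>\<^sub>m U) (1\<^sub>m n)"
  proof -
    have "(1\<^sub>m k - inverse y \<cdot>\<^sub>m (W * U)) * 1\<^sub>m k + W * (inverse y \<cdot>\<^sub>m U) = 1\<^sub>m k"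
      using U W by (intro eq_matI) (auto simp: mult_smult_distrib[OF W U] right_mult_one_mat[of _ k k])
    moreover have "(y \<cdot>\<^sub>m 1\<^sub>m n) * (inverse y \<cdot>\<^sub>m U) = U"
      using U y by (subst mult_smult_assoc_mat[of _ n n _ k]) (auto simp: left_mult_one_mat[of _ n k])
    ultimately show ?thesis
      using U W by (subst mult_four_block_mat[of _ k k _ n _ n]) auto
  qed
  then have "det ?K = det (four_block_mat (1\<^sub>m k - inverse y \<cdot>\<^sub>m (W * U)) W (0\<^sub>m n k) (y \<cdot>\<^sub>m 1\<^sub>m n)) *
      det (four_block_mat (1\<^sub>m k) (0\<^sub>m k n) (inverse y \<cdot>\<^sub>m U) (1\<^sub>m n))"
    using U W by (simp only:, intro det_mult[of _ "k + n"] four_block_carrier_mat) auto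
  also have "\<dots> = det (1\<^sub>m k - inverse y \<cdot>\<^sub>m (W * U)) * y ^ n"
    using U W by (subst det_four_block_mat_upper_right_zero[of _ k _ n], simp_all,
        subst det_four_block_mat_lower_left_zero[of _ k _ n], auto)
  finally have "det ?K = det (1\<^sub>m k - inverse y \<cdot>\<^sub>m (W * U)) * y ^ n" .
  with * show ?thesis by (simp add: mult.commute)
qed

lemma det_3:
  fixes A :: "'b :: comm_ring_1 mat"
  assumes A: "A \<in> carrier_mat 3 3"
  shows "det A = A $$ (0,0) * (A $$ (1,1) * A $$ (2,2) - A $$ (1,2) * A $$ (2,1))
    - A $$ (0,1) * (A $$ (1,0) * A $$ (2,2) - A $$ (1,2) * A $$ (2,0))
    + A $$ (0,2) * (A $$ (1,0) * A $$ (2,1) - A $$ (1,1) * A $$ (2,0))"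
proof -
  have det2: "det B = B $$ (0,0) * B $$ (1,1) - B $$ (0,1) * B $$ (1,0)"
    if B: "B \<in> carrier_mat 2 2" for B :: "'b mat"
    using B laplace_expansion_row[OF B, of 0]
    by (simp add: cofactor_def numeral_eq_Suc mat_delete_def det_single)
  show ?thesis
    using A laplace_expansion_row[OF A, of 0]
    by (simp add: cofactor_def numeral_eq_Suc mat_delete_def det2 algebra_simps)
qed

text \<open>The difference would have infinitely many roots. The exception leaves room for the point
  at which \<open>x + 2\<close> cannot be inverted.\<close>

lemma poly_eqI_except:
  fixes p q :: "real poly"
  assumes "\<And>x. x \<noteq> c \<Longrightarrow> poly p x = poly q x"
  shows "p = q"
proof (rule ccontr)
  assume "p \<noteq> q"
  then have "finite {x. poly (p - q) x = 0}" by (intro poly_roots_finite) simp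
  moreover have "UNIV - {c} \<subseteq> {x. poly (p - q) x = 0}" using assms by auto
  moreover have "infinite (UNIV - {c} :: real set)" using infinite_UNIV_char_0 by auto
  ultimately show False using finite_subset by blast
qed

text \<open>Adding \<open>2I\<close> to \<open>N\<close> leaves a matrix of rank at most 3, so Sylvester's identity reduces the
  determinant to one of size 3.\<close>

lemma charpoly_on_bordered:
  fixes N :: "'i \<Rightarrow> 'i \<Rightarrow> real" and w :: "'i \<Rightarrow> real"
  assumes E: "finite E" "f \<notin> E" "2 \<le> card E"
    and NE: "\<And>e g. e \<in> E \<Longrightarrow> g \<in> E \<Longrightarrow> N e g = (if e = g then 0 else 2)"
    and Nf: "\<And>e. e \<in> E \<Longrightarrow> N f e = w e" "\<And>e. e \<in> E \<Longrightarrow> N e f = w e" "N f f = 0"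
  shows "charpoly_on (insert f E) N = [:2, 1:] ^ (card E - 2) *
    ([:2 - 2 * real (card E), 1:] * [:- (\<Sum>e\<in>E. (w e)\<^sup>2), 2, 1:] - [:2 * (\<Sum>e\<in>E. w e)\<^sup>2:])"
proof (rule poly_eqI_except[where c = "-2"])
  fix x :: real assume "x \<noteq> -2"
  define y where "y = x + 2"
  have y: "y \<noteq> 0" using \<open>x \<noteq> -2\<close> by (simp add: y_def)
  define m where "m = card E"
  define S1 where "S1 = (\<Sum>e\<in>E. w e)"
  define S2 where "S2 = (\<Sum>e\<in>E. (w e)\<^sup>2)"
  let ?n = "Suc m"
  have "finite (insert f E)" "card (insert f E) = ?n" using E by (auto simp: m_def)
  then obtain h where h: "bij_betw h {0..<?n} (insert f E)" by (metis ex_bij_betw_nat_finite)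
  \<comment> \<open>Three rank-one terms add up to \<open>N + 2I\<close>: \<open>c = 0\<close> is
    the block on \<open>E\<close>, constantly 2 once the diagonal is raised; \<open>c = 1\<close> is
    the column of \<open>f\<close> without its diagonal entry; \<open>c = 2\<close> is the row of
    \<open>f\<close> with diagonal entry 2.\<close>
  define u where "u b c = (if c = (0::nat) then of_bool (b \<in> E) else if c = 1 then of_bool (b \<in> E) * w b
     else of_bool (b = f))" for b c
  define v where "v c b = (if c = (0::nat) then 2 * of_bool (b \<in> E) else if c = 1 then of_bool (b = f)
     else of_bool (b \<in> E) * w b + 2 * of_bool (b = f))" for c b
  define U where "U = mat ?n 3 (\<lambda>(a, c). u (h a) c)"
  define W where "W = mat 3 ?n (\<lambda>(c, a). v c (h a))"
  have U: "U \<in> carrier_mat ?n 3" and W: "W \<in> carrier_mat 3 ?n" by (auto simp: U_def W_def)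
  have R: "(\<Sum>c<3. u b c * v c b') = N b b' + (if b = b' then 2 else 0)"
    if "b \<in> insert f E" "b' \<in> insert f E" for b b'
    using that E NE Nf by (auto simp: u_def v_def numeral_eq_Suc)
  have hin: "h a \<in> insert f E" if "a < ?n" for a using h that by (auto simp: bij_betw_def)
  have heq: "h a = h b \<longleftrightarrow> a = b" if "a < ?n" "b < ?n" for a b
    using h that by (auto simp: bij_betw_def inj_on_eq_iff)
  have "mat ?n ?n (\<lambda>(a, b). (if a = b then x else 0) - N (h a) (h b)) = y \<cdot>\<^sub>m 1\<^sub>m ?n - U * W"
  proof (rule eq_matI)
    fix a b assume "a < dim_row (y \<cdot>\<^sub>m 1\<^sub>m ?n - U * W)" "b < dim_col (y \<cdot>\<^sub>m 1\<^sub>m ?n - U * W)"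
    then have ab: "a < ?n" "b < ?n" by (auto simp: U_def W_def)
    then have "(U * W) $$ (a, b) = (\<Sum>c<3. u (h a) c * v c (h b))"
      by (simp add: U_def W_def scalar_prod_def atLeast0LessThan)
    then have "(U * W) $$ (a, b) = N (h a) (h b) + (if a = b then 2 else 0)"
      using R[OF hin hin] ab heq by simp
    then show "mat ?n ?n (\<lambda>(a, b). (if a = b then x else 0) - N (h a) (h b)) $$ (a, b) =
        (y \<cdot>\<^sub>m 1\<^sub>m ?n - U * W) $$ (a, b)"
      using ab U W by (simp add: y_def)
  qed (auto simp: U_def W_def)
  then have "poly (charpoly_on (insert f E) N) x = y ^ ?n * det (1\<^sub>m 3 - inverse y \<cdot>\<^sub>m (W * U))"
    using poly_charpoly_on[OF h] det_smult_one_minus_mult[OF U W y] by simp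
  also have "det (1\<^sub>m 3 - inverse y \<cdot>\<^sub>m (W * U)) =
    (1 - 2 * real m / y) * (1 - 2 / y - S2 / y\<^sup>2) - 2 * S1\<^sup>2 / y ^ 3"
  proof -
    have WU: "(W * U) $$ (c, c') = (\<Sum>b\<in>insert f E. v c b * u b c')" if "c < 3" "c' < 3" for c c'
    proof -
      have "(W * U) $$ (c, c') = (\<Sum>a\<in>{0..<?n}. v c (h a) * u (h a) c')"
        using that by (simp add: U_def W_def scalar_prod_def)
      also have "\<dots> = (\<Sum>b\<in>insert f E. v c b * u b c')"
        by (rule sum.reindex_bij_betw[OF h])
      finally show ?thesis .
    qed
    have uE: "u b c = (if c = 0 then 1 else if c = 1 then w b else 0)"
      and vE: "v c b = (if c = 0 then 2 else if c = 1 then 0 else w b)" if "b \<in> E" for b c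
      using that E by (auto simp: u_def v_def)
    have uf: "u f c = (if c = 0 then 0 else if c = 1 then 0 else 1)"
      and vf: "v c f = (if c = 0 then 0 else if c = 1 then 1 else 2)" for c
      using E by (auto simp: u_def v_def)
    have ent: "(W * U) $$ (0,0) = 2 * real m" "(W * U) $$ (0,1) = 2 * S1" "(W * U) $$ (0,2) = 0"
      "(W * U) $$ (1,0) = 0" "(W * U) $$ (1,1) = 0" "(W * U) $$ (1,2) = 1"
      "(W * U) $$ (2,0) = S1" "(W * U) $$ (2,1) = S2" "(W * U) $$ (2,2) = 2"
      unfolding m_def S1_def S2_def
      by (simp_all add: WU E uE vE uf vf sum_distrib_left power2_eq_square cong: sum.cong)
    have "1\<^sub>m 3 - inverse y \<cdot>\<^sub>m (W * U) \<in> carrier_mat 3 3" using U W by auto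
    from det_3[OF this] have "det (1\<^sub>m 3 - inverse y \<cdot>\<^sub>m (W * U)) =
        (1 - inverse y * (2 * real m)) * (1 - inverse y * 2 - inverse y * (inverse y * S2))
          - inverse y * (2 * S1) * (inverse y * (inverse y * S1))"
      using U W ent by (simp add: algebra_simps)
    then show ?thesis by (simp add: divide_inverse power2_eq_square power3_eq_cube algebra_simps)
  qed
  \<comment> \<open>The factor \<open>y ^ 3\<close> clears the denominators of the determinant of
    size 3. The subtraction is exact because \<open>card E\<close> is at least 2.\<close>
  also have "y ^ ?n = y ^ (m - 2) * y ^ 3"
    using E by (simp add: m_def flip: power_add)
  also have "y ^ (m - 2) * y ^ 3 * ((1 - 2 * real m / y) * (1 - 2 / y - S2 / y\<^sup>2) - 2 * S1\<^sup>2 / y ^ 3) =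
      y ^ (m - 2) * ((y - 2 * real m) * (y\<^sup>2 - 2 * y - S2) - 2 * S1\<^sup>2)"
    using y by (simp add: field_simps power2_eq_square power3_eq_cube)
  also have "\<dots> = poly ([:2, 1:] ^ (card E - 2) *
    ([:2 - 2 * real (card E), 1:] * [:- (\<Sum>e\<in>E. (w e)\<^sup>2), 2, 1:] - [:2 * (\<Sum>e\<in>E. w e)\<^sup>2:])) x"
    unfolding y_def by (simp add: m_def S1_def S2_def power2_eq_square algebra_simps)
  finally show "poly (charpoly_on (insert f E) N) x = \<dots>" .
qed

section \<open>Coefficient sequences\<close>

lemma coeff_linear_factor_0: "coeff ([:2, 1:] * p) 0 = 2 * coeff p 0" for p :: "real poly"
  by simp

lemma coeff_linear_factor_Suc: "coeff ([:2, 1:] * p) (Suc k) = 2 * coeff p (Suc k) + coeff p k"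
  for p :: "real poly"
  by simp

text \<open>The gap splits into the two given gaps and \<open>2 * (b * c - a * d)\<close>, and
  chaining the hypotheses gives \<open>a * d \<le> b * c\<close>. The sign of \<open>d\<close> is
  left open because the top coefficient is negative.\<close>

lemma log_concave_step:
  fixes a b c d :: real
  assumes "0 \<le> a" "0 < b" "0 < c" "a * c \<le> b\<^sup>2" "b * d \<le> c\<^sup>2"
  shows "(2 * b + a) * (2 * d + c) \<le> (2 * c + b)\<^sup>2"
proof -
  have "a * d \<le> b * c"
  proof (cases "d \<le> 0")
    case True
    then have "a * d \<le> 0" using assms by (simp add: mult_nonneg_nonpos)
    also have "0 \<le> b * c" using assms by simp
    finally show ?thesis .
  next
    case False
    have "c * (a * d) = (a * c) * d" by (simp add: ac_simps)
    also have "\<dots> \<le> b\<^sup>2 * d" using assms False by (intro mult_right_mono) auto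
    also have "\<dots> = b * (b * d)" by (simp add: power2_eq_square)
    also have "\<dots> \<le> b * c\<^sup>2" using assms by (intro mult_left_mono) auto
    also have "\<dots> = c * (b * c)" by (simp add: power2_eq_square)
    finally show ?thesis using assms by simp
  qed
  moreover have "(2 * c + b)\<^sup>2 - (2 * b + a) * (2 * d + c)
      = (b\<^sup>2 - a * c) + 4 * (c\<^sup>2 - b * d) + 2 * (b * c - a * d)"
    by (simp add: power2_eq_square algebra_simps)
  ultimately have "0 \<le> (2 * c + b)\<^sup>2 - (2 * b + a) * (2 * d + c)" using assms by simp
  then show ?thesis by simp
qed

text \<open>The top coefficient stays \<open>-1\<close>, and the one below it drops by 2 with every factor
  \<open>x + 2\<close>; hence it stays nonnegative for \<open>M\<close> steps.\<close>

lemma log_concave_linear_power: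
  fixes c0 c1 :: real and M j :: nat
  assumes c: "0 < c0" "0 < c1" "c0 * (2 * real M) \<le> c1\<^sup>2" and "j \<le> M"
  defines "h \<equiv> \<lambda>j. coeff ([:2, 1:] ^ j * [:c0, c1, 2 * real M, -1:])"
  shows "(\<forall>k\<le>j+1. 0 < h j k) \<and> h j (j+2) = 2 * real M - 2 * real j \<and> h j (j+3) = -1 \<and>
    (\<forall>k>j+3. h j k = 0) \<and> (\<forall>k\<le>j+1. h j k * h j (k+2) \<le> (h j (k+1))\<^sup>2)"
  using \<open>j \<le> M\<close>
proof (induction j)
  case 0
  have h0: "h 0 k = (if k = 0 then c0 else if k = 1 then c1 else if k = 2 then 2 * real M
      else if k = 3 then -1 else 0)" for k
    by (simp add: h_def coeff_pCons numeral_eq_Suc split: nat.split)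
  \<comment> \<open>This is the log-concavity inequality at \<open>k = 1\<close>, where the product
    contains the top coefficient -1; the one at \<open>k = 0\<close> is the assumption on
    \<open>c0\<close> and \<open>c1\<close>.\<close>
  have "- c1 \<le> (2 * real M)\<^sup>2" using c zero_le_power2[of "2 * real M"] by linarith
  with c show ?case
    by (auto simp: h0 le_Suc_eq eval_nat_numeral)
next
  case (Suc j)
  then have pos: "\<And>k. k \<le> j+1 \<Longrightarrow> 0 < h j k" and top: "h j (j+2) = 2 * real M - 2 * real j"
    and top': "h j (j+3) = -1" and zero: "\<And>k. k > j+3 \<Longrightarrow> h j k = 0"
    and lc: "\<And>k. k \<le> j+1 \<Longrightarrow> h j k * h j (k+2) \<le> (h j (k+1))\<^sup>2" by auto
  \<comment> \<open>As \<open>j < M\<close>, the coefficient at \<open>j + 2\<close> is still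
    positive, so the positive range can grow by one.\<close>
  have top_pos: "0 < h j (j+2)" using top Suc.prems by simp
  have h: "h (Suc j) 0 = 2 * h j 0" "\<And>k. h (Suc j) (Suc k) = 2 * h j (Suc k) + h j k"
    unfolding h_def power_Suc mult.assoc
    by (rule coeff_linear_factor_0, rule coeff_linear_factor_Suc)
  have pos2: "0 < h j k" if "k \<le> j + 2" for k
    using that pos[of k] top_pos by (cases "k = j + 2") auto
  have pos': "0 < h (Suc j) k" if "k \<le> Suc j + 1" for k
    using that h pos2 by (cases k) (auto simp: add_pos_pos)
  have t1: "h (Suc j) (Suc j + 2) = 2 * real M - 2 * real (Suc j)"
    using h(2)[of "j + 2"] top top' by (simp add: eval_nat_numeral)
  have t2: "h (Suc j) (Suc j + 3) = -1"
    using h(2)[of "j + 3"] top' zero[of "j + 4"] by (simp add: eval_nat_numeral)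
  have t3: "h (Suc j) k = 0" if "k > Suc j + 3" for k
    using that h(2) zero by (cases k) auto
  have "h (Suc j) k * h (Suc j) (k+2) \<le> (h (Suc j) (k+1))\<^sup>2" if k: "k \<le> Suc j + 1" for k
  proof -
    \<comment> \<open>At \<open>k = 0\<close> the missing lower neighbour counts as 0; at the last
      index the product contains the top coefficient -1 and is not positive.\<close>
    consider "k = 0" | l where "k = Suc l" "l \<le> j" | "k = Suc j + 1"
      using k by (cases k) (auto simp: le_Suc_eq)
    then show ?thesis
    proof cases
      case 1
      have "(2 * h j 0 + 0) * (2 * h j 2 + h j 1) \<le> (2 * h j 1 + h j 0)\<^sup>2"
        using pos2[of 0] pos2[of 1] lc[of 0] by (intro log_concave_step) (auto simp: eval_nat_numeral)
      then show ?thesis using h(1) h(2)[of 0] h(2)[of 1] 1 by (simp add: eval_nat_numeral)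
    next
      case 2
      have "(2 * h j (l+1) + h j l) * (2 * h j (l+3) + h j (l+2)) \<le> (2 * h j (l+2) + h j (l+1))\<^sup>2"
        using pos2[of l] pos2[of "l+1"] pos2[of "l+2"] lc[of l] lc[of "l+1"] 2
        by (intro log_concave_step) (auto simp: eval_nat_numeral)
      then show ?thesis using h(2)[of l] h(2)[of "l+1"] h(2)[of "l+2"] 2
        by (simp add: eval_nat_numeral)
    next
      case 3
      have "h (Suc j) k * h (Suc j) (k+2) \<le> 0"
        using 3 t2 pos'[of k] by (simp add: eval_nat_numeral)
      then show ?thesis by (rule order_trans) simp
    qed
  qed
  then show ?case using pos' t1 t2 t3 by blast
qed

section \<open>Unimodality and the position of the mode\<close>

text \<open>Ratios of consecutive terms do not increase, so after the first strict drop all later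
  steps drop too. The mode is the index of that first drop, or \<open>m\<close> if there is none
  before.\<close>

lemma log_concave_imp_unimodal:
  assumes pos: "\<And>k. k \<le> m \<Longrightarrow> 0 < g k" and lc: "log_concave_seq g m"
  shows "unimodal_seq g m"
proof -
  define k where "k = (LEAST k. k \<ge> m \<or> g (k + 1) < g k)"
  have k: "k \<ge> m \<or> g (k + 1) < g k" unfolding k_def by (rule LeastI[of _ m]) simp
  have "k \<le> m" unfolding k_def by (rule Least_le) simp
  moreover have "g (j - 1) \<le> g j" if "1 \<le> j \<and> j \<le> k" for j
  proof -
    have "j - 1 < k" using that by linarith
    then show ?thesis using that not_less_Least[of "j - 1"] unfolding k_def by fastforce
  qed
  moreover have "g (j + 1) < g j" if "k \<le> j" "j < m" for j
    using that
  proof (induction j rule: dec_induct)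
    case base
    then show ?case using k by simp
  next
    case (step j)
    have "g j * g (j + 2) \<le> (g (j + 1))\<^sup>2"
      using lc step.prems unfolding log_concave_seq_def by (auto dest: spec[of _ "j + 1"])
    also have "\<dots> < g j * g (j + 1)"
      using step pos[of "j + 1"] by (simp add: power2_eq_square)
    finally show ?case using pos[of j] step.prems by simp
  qed
  ultimately show ?thesis unfolding unimodal_seq_def by (meson less_imp_le)
qed

text \<open>The coefficients of \<open>(x + 2)^M\<close>, shifted by 3 so that all four terms contributing to a
  coefficient of its product with a cubic have a natural-number index.\<close>

definition shifted_coeff :: "nat \<Rightarrow> nat \<Rightarrow> real" where
  "shifted_coeff M t = (if t < 3 then 0 else coeff ([:2, 1:] ^ M) (t - 3))"

text \<open>This is the ratio of consecutive terms \<open>(M choose s) * 2 ^ (M - s)\<close>,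
  cleared of denominators so that it also holds for \<open>s \<ge> M\<close>.\<close>

lemma coeff_linear_power_rec:
  "2 * (real s + 1) * coeff ([:2, 1:] ^ M) (Suc s) =
    (real M - real s) * coeff ([:2, 1:] ^ M :: real poly) s"
proof (induction M arbitrary: s)
  case 0
  then show ?case by (cases s) auto
next
  case (Suc M)
  let ?b = "coeff ([:2, 1:] ^ M :: real poly)"
  show ?case
  proof (cases s)
    case 0
    then show ?thesis using Suc.IH[of 0] by (simp add: algebra_simps)
  next
    case (Suc r)
    then show ?thesis using Suc.IH[of s] Suc.IH[of r] by (simp add: algebra_simps)
  qed
qed

lemma coeff_linear_power_nonneg: "0 \<le> coeff ([:2, 1:] ^ M :: real poly) s"
proof (induction M arbitrary: s)
  case (Suc M)
  then show ?case by (cases s) auto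
qed (auto simp: coeff_1)

lemma coeff_linear_power_pos: "s \<le> M \<Longrightarrow> 0 < coeff ([:2, 1:] ^ M :: real poly) s"
proof (induction M arbitrary: s)
  case (Suc M)
  then show ?case
    using coeff_linear_power_nonneg[of M s]
    by (cases s) (auto simp: add_nonneg_pos)
qed (auto simp: coeff_1)

text \<open>The recurrence survives the padding with zeros: at \<open>t = 2\<close>, where the
  sequence jumps from 0 to a positive value, the factor \<open>real t - 2\<close> vanishes.\<close>

lemma shifted_coeff_rec:
  "2 * (real t - 2) * shifted_coeff M (Suc t) = (real M + 3 - real t) * shifted_coeff M t"
proof (cases "t < 3")
  case True
  then consider "t < 2" | "t = 2" by linarith
  then show ?thesis by cases (auto simp: shifted_coeff_def)
next
  case False
  then show ?thesis using coeff_linear_power_rec[of "t - 3" M]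
    by (simp add: shifted_coeff_def Suc_diff_le[symmetric] of_nat_diff algebra_simps)
qed

lemma shifted_coeff_nonneg: "0 \<le> shifted_coeff M t"
  by (simp add: shifted_coeff_def coeff_linear_power_nonneg)

lemma shifted_coeff_pos: "3 \<le> t \<Longrightarrow> t \<le> M + 3 \<Longrightarrow> 0 < shifted_coeff M t"
  by (simp add: shifted_coeff_def coeff_linear_power_pos)

lemma coeff_linear_power_mult_cubic:
  "coeff ([:2, 1:] ^ M * [:c0, c1, c2, -1:]) k =
     c0 * shifted_coeff M (k+3) + c1 * shifted_coeff M (k+2) + c2 * shifted_coeff M (k+1)
       - shifted_coeff M k"
proof -
  have "[:2, 1:] ^ M * [:c0, c1, c2, -1:] = [:c0, c1, c2, -1:] * [:2, 1:] ^ M"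
    by (rule mult.commute)
  then show ?thesis
    by (simp add: shifted_coeff_def coeff_pCons numeral_eq_Suc split: nat.split)
qed

text \<open>The condition \<open>3 * k + 2 \<le> M\<close> says that the coefficients of
  \<open>(x + 2)^M\<close> do not fall from index \<open>k\<close> to \<open>k + 1\<close>. The
  increments weighted by \<open>c0\<close> and \<open>c1\<close> then help, and the weight
  \<open>2 * real M\<close> of the third one outweighs the term with coefficient -1.\<close>

lemma coeff_increasing_left:
  assumes c: "0 < c0" "0 < c1" and k: "3 * k + 2 \<le> M"
  shows "coeff ([:2, 1:] ^ M * [:c0, c1, 2 * real M, -1:]) k
    < coeff ([:2, 1:] ^ M * [:c0, c1, 2 * real M, -1:]) (Suc k)"
proof -
  let ?b = "shifted_coeff M"
  have k': "3 * real k + 2 \<le> real M" using k by linarith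
  have "2 * (real k + 1) * ?b (k+3) \<le> (real M - real k) * ?b (k+3)"
    using k' by (intro mult_right_mono shifted_coeff_nonneg) simp
  also have "\<dots> = 2 * (real k + 1) * ?b (k+4)"
    using shifted_coeff_rec[of "k+3" M] by (simp add: eval_nat_numeral algebra_simps)
  finally have 1: "?b (k+3) \<le> ?b (k+4)" by simp
  have 2: "?b (k+2) < ?b (k+3)"
  proof (cases "k = 0")
    case True
    then show ?thesis using shifted_coeff_pos[of 3 M] by (simp add: shifted_coeff_def eval_nat_numeral)
  next
    case False
    have "2 * real k * ?b (k+2) < (real M + 1 - real k) * ?b (k+2)"
      using k' False k by (intro mult_strict_right_mono shifted_coeff_pos) linarith+
    also have "\<dots> = 2 * real k * ?b (k+3)"
      using shifted_coeff_rec[of "k+2" M] by (simp add: eval_nat_numeral algebra_simps)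
    finally show ?thesis using False by simp
  qed
  have 3: "?b (k+1) - ?b k \<le> 2 * real M * (?b (k+2) - ?b (k+1))"
  proof (cases "k \<le> 1")
    case True
    then have "?b (k+1) = 0" "?b k = 0" by (auto simp: shifted_coeff_def)
    then show ?thesis using shifted_coeff_nonneg[of M] by simp
  next
    case False
    \<comment> \<open>The constant 6 is the least value of \<open>real M + 4 - 3 * real k\<close>
      under \<open>3 * k + 2 \<le> M\<close>.\<close>
    have "?b (k+1) - ?b k \<le> 6 * ?b (k+1)"
      using shifted_coeff_nonneg[of M k] shifted_coeff_nonneg[of M "k+1"] by linarith
    also have "\<dots> \<le> (real M + 4 - 3 * real k) * ?b (k+1)"
      using k' by (intro mult_right_mono shifted_coeff_nonneg) linarith
    also have eq: "\<dots> = 2 * (real k - 1) * (?b (k+2) - ?b (k+1))"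
      using shifted_coeff_rec[of "k+1" M] by (simp add: eval_nat_numeral algebra_simps)
    also have "\<dots> \<le> 2 * real M * (?b (k+2) - ?b (k+1))"
    proof (rule mult_right_mono)
      have "0 \<le> (real M + 4 - 3 * real k) * ?b (k+1)"
        using k' by (intro mult_nonneg_nonneg shifted_coeff_nonneg) linarith
      then show "0 \<le> ?b (k+2) - ?b (k+1)"
        unfolding eq using False by (simp add: zero_le_mult_iff)
    qed (use k' in simp)
    finally show ?thesis .
  qed
  have "c0 * ?b (k+3) \<le> c0 * ?b (k+4)" "c1 * ?b (k+2) < c1 * ?b (k+3)"
    using c 1 2 by auto
  then show ?thesis unfolding coeff_linear_power_mult_cubic
    using 3 by (simp add: eval_nat_numeral algebra_simps)
qed

text \<open>Mirror image of \<open>coeff_increasing_left\<close>: rounding in \<open>M div 3\<close>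
  still leaves \<open>M + 4 \<le> 3 * k\<close>, beyond the peak of \<open>(x + 2)^M\<close>, and
  again the weight \<open>2 * real M\<close> absorbs the term of opposite sign.\<close>

lemma coeff_decreasing_right:
  assumes c: "0 < c0" "0 < c1" and k: "M div 3 + 2 \<le> k" "k \<le> M"
  shows "coeff ([:2, 1:] ^ M * [:c0, c1, 2 * real M, -1:]) (Suc k)
    < coeff ([:2, 1:] ^ M * [:c0, c1, 2 * real M, -1:]) k"
proof -
  let ?b = "shifted_coeff M"
  have k': "real M + 4 \<le> 3 * real k" "2 \<le> k" using k by linarith+
  have "2 * (real k + 1) * ?b (k+4) = (real M - real k) * ?b (k+3)"
    using shifted_coeff_rec[of "k+3" M] by (simp add: eval_nat_numeral algebra_simps)
  also have "\<dots> \<le> 2 * (real k + 1) * ?b (k+3)"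
    using k' by (intro mult_right_mono shifted_coeff_nonneg) simp
  finally have 1: "?b (k+4) \<le> ?b (k+3)" by simp
  have "2 * real k * ?b (k+3) = (real M + 1 - real k) * ?b (k+2)"
    using shifted_coeff_rec[of "k+2" M] by (simp add: eval_nat_numeral algebra_simps)
  also have "\<dots> < 2 * real k * ?b (k+2)"
    using k' k by (intro mult_strict_right_mono shifted_coeff_pos) linarith+
  finally have 2: "?b (k+3) < ?b (k+2)" using k' by simp
  have 3: "?b k - ?b (k+1) \<le> 2 * real M * (?b (k+1) - ?b (k+2))"
  proof -
    \<comment> \<open>By the recurrence both decrements are multiples of \<open>?b (k+1)\<close>,
      with numerators \<open>?D\<close> and \<open>?D + 3\<close>. Only the second is surely
      nonnegative, as \<open>?D\<close> may be as small as -3.\<close>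
    let ?D = "3 * real k - real M - 7"
    have eq1: "(real M + 3 - real k) * (?b k - ?b (k+1)) = ?D * ?b (k+1)"
      using shifted_coeff_rec[of k M] by (simp add: eval_nat_numeral algebra_simps)
    have eq2: "2 * (real k - 1) * (?b (k+1) - ?b (k+2)) = (?D + 3) * ?b (k+1)"
      using shifted_coeff_rec[of "k+1" M] by (simp add: eval_nat_numeral algebra_simps)
    have nn: "0 \<le> (?D + 3) * ?b (k+1)"
      using k' by (intro mult_nonneg_nonneg shifted_coeff_nonneg) linarith
    then have dec: "0 \<le> ?b (k+1) - ?b (k+2)"
      unfolding eq2[symmetric] using k' by (simp add: zero_le_mult_iff)
    have "?b k - ?b (k+1) \<le> (?D + 3) * ?b (k+1)"
    proof (cases "?b k - ?b (k+1) \<le> 0")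
      case False
      then have "?b k - ?b (k+1) \<le> (real M + 3 - real k) * (?b k - ?b (k+1))"
        using k by (simp add: mult_le_cancel_right1)
      also have "\<dots> \<le> (?D + 3) * ?b (k+1)"
        unfolding eq1 by (intro mult_right_mono shifted_coeff_nonneg) simp
      finally show ?thesis .
    qed (use nn in linarith)
    also have "\<dots> = 2 * (real k - 1) * (?b (k+1) - ?b (k+2))" using eq2 by simp
    also have "\<dots> \<le> 2 * real M * (?b (k+1) - ?b (k+2))"
      using dec k by (intro mult_right_mono) auto
    finally show ?thesis .
  qed
  have "c0 * ?b (k+4) \<le> c0 * ?b (k+3)" "c1 * ?b (k+3) < c1 * ?b (k+2)"
    using c 1 2 by auto
  then show ?thesis unfolding coeff_linear_power_mult_cubic
    using 3 by (simp add: eval_nat_numeral algebra_simps)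
qed

section \<open>The cubic factor of a tree and the resulting bounds\<close>

theorem theorem1p3:
  fixes V :: "'a set" and E :: "'a set set" and i j :: 'a and n :: nat
  assumes tree: "is_tree V E"
    and n_def: "n = card V"
    and ij: "i \<in> V" "j \<in> V" "i \<noteq> j"
    and notE: "{i, j} \<notin> E"
  defines "a \<equiv> (\<lambda>k. coeff (charpoly_on (insert {i, j} E) (\<lambda>p q. Min4PC E p q)) k)"
  shows "unimodal_seq (\<lambda>k. \<bar>a k\<bar>) (n - 2) \<and> log_concave_seq (\<lambda>k. \<bar>a k\<bar>) (n - 2) \<and>
         (\<forall>t\<le>n - 2. \<bar>a t\<bar> = Max {\<bar>a k\<bar> | k. k \<le> n - 2} \<longrightarrow>
           (n - 2) div 3 \<le> t \<and> t \<le> (n + 3) div 3)"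
proof -
  interpret tree V E using tree by unfold_locales
  define m where "m = card E"
  define M where "M = m - 2"
  define \<delta> where "\<delta> = d i j"
  define P where "P = path_edges i j"
  define w where "w e = (if e \<in> P then real \<delta> - 1 else real \<delta> + 1)" for e
  have PE: "P \<subseteq> E" unfolding P_def path_edges_def by auto
  have cardP: "card P = \<delta>" unfolding P_def \<delta>_def by (rule path_edges_geodesic(1)[OF ij(1,2)])
  have "\<delta> \<noteq> 0" using d_0 ij unfolding \<delta>_def by blast
  moreover have "\<delta> \<noteq> 1"
  proof
    assume "\<delta> = 1"
    then obtain u where "{u, j} \<in> E" "d i u = 0"
      using ex_parent[OF ij(1,2), of 0] unfolding \<delta>_def by auto
    then show False using d_0[of i u] edgeD[of u j] ij notE by metis
  qed
  ultimately have d2: "2 \<le> \<delta>" by linarith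
  \<comment> \<open>With \<open>2 \<le> \<delta>\<close> this gives \<open>2 \<le> m\<close>, so
    \<open>M = m - 2\<close> is an exact subtraction and \<open>n = M + 3\<close>.\<close>
  have dm: "\<delta> \<le> m" unfolding m_def cardP[symmetric] using finite_E PE by (rule card_mono)
  have n: "n = M + 3" using card_V n_def d2 dm unfolding M_def m_def by linarith
  have m: "m = M + 2" using d2 dm unfolding M_def by linarith
  have sumP: "(\<Sum>e\<in>E. of_bool (e \<in> P)) = real \<delta>"
    using PE finite_E cardP by (simp add: Int_absorb1)
  have "(\<Sum>e\<in>E. w e) = (\<Sum>e\<in>E. (real \<delta> + 1) - 2 * of_bool (e \<in> P))"
    by (rule sum.cong) (auto simp: w_def)
  also have "\<dots> = real m * (real \<delta> + 1) - 2 * real \<delta>"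
    by (simp only: sum_subtractf sum_distrib_left[symmetric] sumP) (simp add: m_def)
  finally have S1: "(\<Sum>e\<in>E. w e) = real m * (real \<delta> + 1) - 2 * real \<delta>" .
  \<comment> \<open>The squares of \<open>\<delta> + 1\<close> and \<open>\<delta> - 1\<close>
    differ by \<open>4 * \<delta>\<close>.\<close>
  have "(\<Sum>e\<in>E. (w e)\<^sup>2) = (\<Sum>e\<in>E. (real \<delta> + 1)\<^sup>2 - 4 * real \<delta> * of_bool (e \<in> P))"
    by (rule sum.cong) (auto simp: w_def power2_eq_square algebra_simps)
  also have "\<dots> = real m * (real \<delta> + 1)\<^sup>2 - 4 * (real \<delta>)\<^sup>2"
    by (simp only: sum_subtractf sum_distrib_left[symmetric] sumP) (simp add: m_def power2_eq_square)
  finally have S2: "(\<Sum>e\<in>E. (w e)\<^sup>2) = real m * (real \<delta> + 1)\<^sup>2 - 4 * (real \<delta>)\<^sup>2" .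
  \<comment> \<open>With \<open>S1\<close> and \<open>S2\<close> the sums of \<open>w\<close> and of
    its squares, expansion gives \<open>c0 = 2 * S1^2 - 2 * (m - 1) * S2\<close> and
    \<open>c1 = 4 * m - 4 + S2\<close>. In \<open>c0\<close> everything cancels except a
    square.\<close>
  define c0 where "c0 = 2 * real m * (real \<delta> - 1)\<^sup>2"
  define c1 where "c1 = 4 * real m - 4 + real m * (real \<delta> + 1)\<^sup>2 - 4 * (real \<delta>)\<^sup>2"
  define h where "h = coeff ([:2, 1:] ^ M * [:c0, c1, 2 * real M, -1:])"
  have "charpoly_on (insert {i, j} E) (Min4PC E) = [:2, 1:] ^ (card E - 2) *
    ([:2 - 2 * real (card E), 1:] * [:- (\<Sum>e\<in>E. (w e)\<^sup>2), 2, 1:] - [:2 * (\<Sum>e\<in>E. w e)\<^sup>2:])"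
    using Min4PC_pair_edge[OF ij] Min4PC_self[OF ij(3)] Min4PC_edge_edge finite_E notE d2 dm
    by (intro charpoly_on_bordered) (auto simp: w_def P_def \<delta>_def m_def)
  also have "[:2 - 2 * real (card E), 1:] * [:- (\<Sum>e\<in>E. (w e)\<^sup>2), 2, 1:] - [:2 * (\<Sum>e\<in>E. w e)\<^sup>2:]
      = - [:c0, c1, 2 * real M, -1:]"
    unfolding S1 S2 c0_def c1_def m_def[symmetric]
    by (simp add: m power2_eq_square algebra_simps)
  finally have "charpoly_on (insert {i, j} E) (Min4PC E) = - ([:2, 1:] ^ M * [:c0, c1, 2 * real M, -1:])"
    unfolding M_def m_def by simp
  then have a: "a k = - h k" for k by (simp only: a_def coeff_minus h_def)
  have c0: "0 < c0" using d2 dm by (simp add: c0_def)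
  \<comment> \<open>Replacing \<open>\<delta>^2\<close> by the larger \<open>m * \<delta>\<close>
    turns \<open>m * (\<delta> + 1)^2 - 4 * \<delta>^2\<close> into
    \<open>m * (\<delta> - 1)^2\<close>.\<close>
  have c1: "real m * (real \<delta> - 1)\<^sup>2 + 4 * (real m - 1) \<le> c1"
  proof -
    have "real \<delta> * real \<delta> \<le> real m * real \<delta>" using dm by (intro mult_right_mono) auto
    then show ?thesis by (simp add: c1_def power2_eq_square algebra_simps)
  qed
  have nn: "0 \<le> real m * (real \<delta> - 1)\<^sup>2" "0 < real m - 1" using m by auto
  then have "0 < real m * (real \<delta> - 1)\<^sup>2 + 4 * (real m - 1)" by (intro add_nonneg_pos) auto
  then have c1_pos: "0 < c1" using c1 by (rule less_le_trans)
  have lc0: "c0 * (2 * real M) \<le> c1\<^sup>2"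
  proof -
    \<comment> \<open>Since \<open>c0 = 2 * ?q\<close>, the left side is at most the mixed term in
      the square of the lower bound for \<open>c1\<close>.\<close>
    let ?q = "real m * (real \<delta> - 1)\<^sup>2"
    have "c0 * (2 * real M) = ?q * (4 * (real m - 2))" by (simp add: c0_def m algebra_simps)
    also have "\<dots> \<le> ?q * (8 * (real m - 1))" using nn m by (intro mult_left_mono) auto
    also have "\<dots> \<le> (?q + 4 * (real m - 1))\<^sup>2"
    proof -
      have "(q + 4 * r)\<^sup>2 = q * (8 * r) + (q\<^sup>2 + 16 * r\<^sup>2)" for q r :: real
        by (simp add: power2_eq_square algebra_simps)
      then have "q * (8 * r) \<le> (q + 4 * r)\<^sup>2" for q r :: real by simp
      then show ?thesis .
    qed
    also have "\<dots> \<le> c1\<^sup>2" using c1 nn by (intro power_mono) auto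
    finally show ?thesis .
  qed
  \<comment> \<open>At \<open>j = M\<close> the positive range ends at \<open>M + 1 = n - 2\<close>,
    and the next coefficient \<open>2 * M - 2 * M\<close> is zero.\<close>
  note H = log_concave_linear_power[OF c0 c1_pos lc0 order_refl, folded h_def]
  have pos: "0 < h k" if "k \<le> M + 1" for k using H that by blast
  have abs_a: "\<bar>a k\<bar> = h k" if "k \<le> M + 1" for k using a pos[OF that] by simp
  have n2: "n - 2 = M + 1" using n by simp
  have lc: "log_concave_seq (\<lambda>k. \<bar>a k\<bar>) (n - 2)"
    unfolding log_concave_seq_def
  proof (intro allI impI)
    fix k assume k: "1 \<le> k \<and> k + 1 \<le> n - 2"
    then obtain l where l: "k = Suc l" "l \<le> M + 1" using n2 by (cases k) auto
    then have "h l * h (l + 2) \<le> (h (l + 1))\<^sup>2" using H by blast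
    then have "h (k - 1) * h (k + 1) \<le> (h k)\<^sup>2" using l by simp
    then show "\<bar>a (k - 1)\<bar> * \<bar>a (k + 1)\<bar> \<le> \<bar>a k\<bar>\<^sup>2"
      using abs_a[of "k - 1"] abs_a[of k] abs_a[of "k + 1"] k l n2 by simp
  qed
  have "0 < \<bar>a k\<bar>" if "k \<le> n - 2" for k using abs_a pos that n2 by simp
  then have "unimodal_seq (\<lambda>k. \<bar>a k\<bar>) (n - 2)" using lc by (rule log_concave_imp_unimodal)
  moreover have "(n - 2) div 3 \<le> t \<and> t \<le> (n + 3) div 3"
    if t: "t \<le> n - 2" and max: "\<bar>a t\<bar> = Max {\<bar>a k\<bar> | k. k \<le> n - 2}" for t
  proof -
    have le: "h k \<le> h t" if "k \<le> M + 1" for k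
    proof -
      have "\<bar>a k\<bar> \<le> Max {\<bar>a k\<bar> | k. k \<le> n - 2}"
        using that n2 by (intro Max_ge) auto
      then show ?thesis using max abs_a that t n2 by simp
    qed
    have "(n - 2) div 3 \<le> t"
    proof (rule ccontr)
      assume "\<not> ?thesis"
      \<comment> \<open>From \<open>t + 1 \<le> (M + 1) div 3\<close>, exactly the range of
        \<open>coeff_increasing_left\<close>.\<close>
      then have "3 * t + 2 \<le> M" using n2 by linarith
      then show False using coeff_increasing_left[OF c0 c1_pos, of t M, folded h_def] le[of "Suc t"] by simp
    qed
    moreover have "t \<le> (n + 3) div 3"
    proof (rule ccontr)
      assume "\<not> ?thesis"
      \<comment> \<open>Here \<open>(n + 3) div 3\<close>, the ceiling of
        \<open>(n + 1) / 3\<close>, equals \<open>M div 3 + 2\<close>; a larger \<open>t\<close> has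
        a strictly larger coefficient just before it.\<close>
      then have "M div 3 + 2 \<le> t - 1" "t - 1 \<le> M" "Suc (t - 1) = t" using n t by linarith+
      then show False
        using coeff_decreasing_right[OF c0 c1_pos, of M "t - 1", folded h_def] le[of "t - 1"] by simp
    qed
    ultimately show ?thesis by blast
  qed
  ultimately show ?thesis using lc by blast
qed

end
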